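(* Let $\phi=(1+\sqrt5)/2$ and for an integer $k\ge1$ define $$A(k,1)=\sum_{n=1}^{F_k-1}\lfloor\phi n\rfloor,\qquad A'(k,1)=\sum_{n=1}^{F_k-1}\lfloor\phi^2 n\rfloor.$$ Then for every integer $k\ge1$, $$\operatorname{LCM}\bigl(A(2k,1),A'(2k,1)\bigr)=\begin{cases}\dfrac12F_{k+1}F_kL_{k+2}L_{k+1}L_{k-1} & \text{if $k$ is even},\\[4.5pt] \dfrac12F_{k+2}F_{k+1}F_{k-1}L_{k+1}L_k & \text{if $k$ is odd}.\end{cases}$$
   Context: $\lfloor x\rfloor$ denotes the integer part of $x$; an empty sum is $0$. The Fibonacci numbers $F_n$ and Lucas numbers $L_n$ are defined by $F_0=0$, $F_1=1$, $L_0=2$, $L_1=1$ and $F_{n+2}=F_{n+1}+F_n$, $L_{n+2}=L_{n+1}+L_n$ for $n\ge0$. $\operatorname{LCM}$ denotes the least common multiple (with $\operatorname{LCM}(0,0)=0$). *)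

theory Defs
  imports Complex_Main "HOL-Number_Theory.Fib"
begin

definition phi :: real where
  "phi = (1 + sqrt 5) / 2"

fun lucas :: "nat \<Rightarrow> nat" where
  "lucas 0 = 2"
| "lucas (Suc 0) = 1"
| "lucas (Suc (Suc n)) = lucas (Suc n) + lucas n"

(* A1 k and A1' k are A(k,1) and A'(k,1). For k \<ge> 1 we have fib k \<ge> 1,
   so the natural-number subtraction in the upper limit is exact. *)
definition A1 :: "nat \<Rightarrow> int" where
  "A1 k = (\<Sum>n = 1..fib k - 1. \<lfloor>phi * real n\<rfloor>)"

definition A1' :: "nat \<Rightarrow> int" where
  "A1' k = (\<Sum>n = 1..fib k - 1. \<lfloor>phi\<^sup>2 * real n\<rfloor>)"

end

theory Submission
  imports Defs
begin

text \<open>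
  Put \<open>q = F\<^bsub>2k\<^esub>\<close> and \<open>p = F\<^bsub>2k+1\<^esub>\<close>. Cassini's identity gives
  \<open>(p - q \<phi>) (p + q (\<phi> - 1)) = 1\<close>, so \<open>p/q\<close> exceeds \<open>\<phi>\<close> by less than \<open>1/q\<^sup>2\<close>.
  Since \<open>p n / q\<close> is not an integer for \<open>0 < n < q\<close>, it has the same floor as \<open>\<phi> n\<close>. Pairing
  \<open>n\<close> with \<open>q - n\<close> then gives \<open>2 A(2k,1) = (q - 1) (p - 1)\<close>, and \<open>\<phi>\<^sup>2 = \<phi> + 1\<close> gives
  \<open>2 A'(2k,1) = (q - 1) (p + q - 1)\<close>. Each of \<open>F\<^bsub>2k\<^esub> - 1\<close>, \<open>F\<^bsub>2k+1\<^esub> - 1\<close>, \<open>F\<^bsub>2k+2\<^esub> - 1\<close>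
  is a Fibonacci number times a Lucas number, and after removing the common factor of the two
  products, consecutive (hence coprime) Lucas or Fibonacci numbers remain.
\<close>

lemma phi_square: "phi\<^sup>2 = phi + 1"
  by (simp add: phi_def power2_eq_square field_simps)

lemma phi_gt_1: "phi > 1"
  by (simp add: phi_def)

lemma lucas_eq_fib: "int (lucas n) = 2 * int (fib (Suc n)) - int (fib n)"
  by (induction n rule: lucas.induct) auto

lemma coprime_lucas_Suc: "coprime (lucas n) (lucas (Suc n))"
proof (induction n)
  case (Suc n)
  then show ?case
    by (simp add: coprime_iff_gcd_eq_1 gcd.commute)
qed simp

text \<open>Cassini's identity in the shape used twice: for even \<open>n\<close> it is the
  hypothesis of the floor lemmas, and its sign separates the parities in the factorizations.\<close>

lemma fib_quadratic_form:
  "int (fib (Suc n)) ^ 2 - int (fib (Suc n)) * int (fib n) - int (fib n) ^ 2 = (- 1) ^ n"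
  using fib_Cassini_int[of n] by (simp add: power2_eq_square algebra_simps)

text \<open>A common divisor of \<open>p\<close> and \<open>q\<close> divides the form, hence 1; so
  \<open>q\<close> would have to divide the smaller \<open>n\<close>.\<close>

lemma not_dvd_mult_if_quadratic_form:
  fixes p q n :: int
  assumes form: "p\<^sup>2 - p * q - q\<^sup>2 = 1" and n: "0 < n" "n < q"
  shows "\<not> q dvd p * n"
proof
  assume "q dvd p * n"
  moreover have "coprime q p"
  proof (rule coprimeI)
    fix d assume "d dvd q" "d dvd p"
    then have "d dvd p\<^sup>2 - p * q - q\<^sup>2" by (simp add: power2_eq_square)
    then show "is_unit d" by (simp add: form)
  qed
  ultimately have "q dvd n" by (simp add: coprime_dvd_mult_right_iff)
  then show False using n zdvd_not_zless by blast
qed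

lemma floor_phi_mult_eq_div:
  fixes p q n :: int
  assumes form: "p\<^sup>2 - p * q - q\<^sup>2 = 1" and "p \<ge> 0" and n: "0 < n" "n < q"
  shows "\<lfloor>phi * of_int n\<rfloor> = p * n div q"
proof -
  \<comment> \<open>\<open>e\<close> is \<open>q\<close> times the error of \<open>p / q\<close>,
    and \<open>s\<close> is its conjugate, since \<open>phi\<close> has conjugate
    \<open>1 - phi\<close>; their product is the quadratic form.\<close>
  define e where "e = of_int p - of_int q * phi"
  define s where "s = of_int p + of_int q * (phi - 1)"
  define m r where "m = p * n div q" and "r = p * n mod q"
  have q: "q > 0" using n by simp
  have "e * s = of_int p ^ 2 - of_int p * of_int q - of_int q ^ 2 * (phi\<^sup>2 - phi)"
    by (simp add: e_def s_def power2_eq_square algebra_simps)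
  also have "\<dots> = of_int (p\<^sup>2 - p * q - q\<^sup>2)"
    by (simp add: phi_square)
  finally have es: "e * s = 1" by (simp add: form)
  have "p > q"
  proof (rule ccontr)
    assume "\<not> p > q"
    then have "p * p \<le> p * q" using \<open>p \<ge> 0\<close> by (simp add: mult_left_mono)
    then show False using form zero_le_square[of q] unfolding power2_eq_square by linarith
  qed
  have s: "s > of_int q"
  proof -
    have "of_int q * (phi - 1) > 0" using q phi_gt_1 by simp
    then show ?thesis using \<open>p > q\<close> by (simp add: s_def)
  qed
  have e: "e > 0" using es s q
    by (metis less_trans of_int_0_less_iff zero_less_mult_pos2 zero_less_one)
  have "of_int n * e < of_int q * e" using n e by simp
  also have "\<dots> < 1" using es s e by (metis mult.commute mult_strict_left_mono)
  finally have ne: "of_int n * e < 1" .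
  have "r \<noteq> 0"
  proof
    assume "r = 0"
    then show False
      using not_dvd_mult_if_quadratic_form[OF form n] by (simp add: r_def dvd_eq_mod_eq_0)
  qed
  then have r: "1 \<le> r" "r < q"
    using pos_mod_sign[OF q, of "p * n"] pos_mod_bound[OF q, of "p * n"] unfolding r_def
    by linarith+
  have "of_int q * (phi * of_int n) = of_int (p * n) - of_int n * e"
    by (simp add: e_def algebra_simps)
  also have "p * n = q * m + r" by (simp add: m_def r_def)
  finally have eq: "of_int q * (phi * of_int n) = of_int q * of_int m + of_int r - of_int n * e"
    by simp
  \<comment> \<open>As \<open>1 \<le> r < q\<close> and \<open>0 < n * e < 1\<close>, subtracting
    \<open>n * e\<close> does not cross a multiple of \<open>q\<close>.\<close>
  have "of_int q * of_int m \<le> of_int q * (phi * of_int n)"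
    using eq ne r by linarith
  moreover have "of_int n * e > 0" using n e by simp
  then have "of_int q * (phi * of_int n) < of_int q * (of_int m + 1)"
    using eq r by (simp add: distrib_left)
  ultimately have "of_int m \<le> phi * of_int n" "phi * of_int n < of_int m + 1"
    using q by simp_all
  then show ?thesis unfolding m_def by (rule floor_unique)
qed

text \<open>The fractions \<open>p * n / q\<close> and \<open>p * (q - n) / q\<close> add up to
  \<open>p\<close> and are not integers, so their floors lose exactly 1.\<close>

lemma floor_phi_mult_reflect:
  fixes p q n :: int
  assumes form: "p\<^sup>2 - p * q - q\<^sup>2 = 1" and "p \<ge> 0" and n: "0 < n" "n < q"
  shows "\<lfloor>phi * of_int n\<rfloor> + \<lfloor>phi * of_int (q - n)\<rfloor> = p - 1"
proof -
  have "\<not> q dvd p * n" by (rule not_dvd_mult_if_quadratic_form[OF form n])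
  have "p * (q - n) div q = (- (p * n) + p * q) div q"
    by (simp add: algebra_simps)
  also have "\<dots> = p + - (p * n) div q"
    using n by (subst div_mult_self1) auto
  also have "- (p * n) div q = - (p * n div q) - 1"
    using \<open>\<not> q dvd p * n\<close> n by (simp add: zdiv_zminus1_eq_if dvd_eq_mod_eq_0)
  finally show ?thesis
    using assms floor_phi_mult_eq_div[of p q n] floor_phi_mult_eq_div[of p q "q - n"] by simp
qed

lemma double_A1:
  assumes "even N" "N > 0"
  shows "2 * A1 N = (int (fib N) - 1) * (int (fib (Suc N)) - 1)"
proof -
  let ?q = "fib N" and ?f = "\<lambda>n. \<lfloor>phi * real n\<rfloor>"
  have form: "int (fib (Suc N)) ^ 2 - int (fib (Suc N)) * int ?q - int ?q ^ 2 = 1"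
    using fib_quadratic_form[of N] assms by simp
  have q: "?q > 0" using assms fib_neq_0_nat by simp
  have "2 * A1 N = (\<Sum>n = 1..?q - 1. ?f n) + (\<Sum>n = 1..?q - 1. ?f (?q - n))"
    unfolding A1_def using q sum.atLeastAtMost_rev[of ?f 1 "?q - 1"] by simp
  also have "\<dots> = (\<Sum>n = 1..?q - 1. ?f n + ?f (?q - n))"
    by (simp add: sum.distrib)
  also have "\<dots> = (\<Sum>n = 1..?q - 1. int (fib (Suc N)) - 1)"
  proof (rule sum.cong)
    fix n assume "n \<in> {1..?q - 1}"
    then have "0 < n" "n < ?q" using q by auto
    then show "?f n + ?f (?q - n) = int (fib (Suc N)) - 1"
      using floor_phi_mult_reflect[OF form, of "int n"] by (simp add: of_nat_diff)
  qed simp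
  also have "\<dots> = (int ?q - 1) * (int (fib (Suc N)) - 1)"
    using q by (simp add: of_nat_diff)
  finally show ?thesis .
qed

lemma double_A1'_eq_double_A1: "2 * A1' N = 2 * A1 N + int (fib N) * (int (fib N) - 1)"
proof -
  have "\<lfloor>phi\<^sup>2 * real n\<rfloor> = \<lfloor>phi * real n\<rfloor> + int n" for n
  proof -
    have "phi\<^sup>2 * real n = phi * real n + of_int (int n)"
      by (simp add: phi_square distrib_right)
    then show ?thesis by (simp only: floor_add_int)
  qed
  then have "A1' N = A1 N + (\<Sum>n = 1..fib N - 1. int n)"
    by (simp add: A1_def A1'_def sum.distrib)
  moreover have "2 * (\<Sum>n = 1..m. int n) = int m * (int m + 1)" for m
    by (induction m) (auto simp: algebra_simps)
  ultimately show ?thesis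
    \<comment> \<open>If \<open>fib N = 0\<close>, the truncated upper limit is 0 and both sides
      vanish.\<close>
    by (cases "fib N") (auto simp: algebra_simps)
qed

lemma double_A1':
  assumes "even N" "N > 0"
  shows "2 * A1' N = (int (fib N) - 1) * (int (fib (N + 2)) - 1)"
  using double_A1'_eq_double_A1[of N] double_A1[OF assms] by (simp add: algebra_simps)

text \<open>Written in \<open>a = fib (k - 1)\<close> and \<open>b = fib k\<close>, the two sides of
  each equation differ by a multiple of Cassini's identity, whose sign depends on the parity of
  \<open>k\<close>.\<close>

lemma fib_minus_1_factorization:
  assumes "k \<ge> 1"
  shows "int (fib (2 * k)) - 1 =
      (if even k then int (fib (k + 1) * lucas (k - 1)) else int (fib (k - 1) * lucas (k + 1)))"
    and "int (fib (2 * k + 1)) - 1 =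
      (if even k then int (fib k * lucas (k + 1)) else int (fib (k + 1) * lucas k))"
    and "int (fib (2 * k + 2)) - 1 =
      (if even k then int (fib k * lucas (k + 2)) else int (fib (k + 2) * lucas k))"
proof -
  obtain m where k: "k = Suc m" using assms by (cases k) auto
  define a b where "a = int (fib m)" and "b = int (fib (Suc m))"
  have F2: "int (fib (Suc (Suc m))) = a + b" and F3: "int (fib (Suc (Suc (Suc m)))) = a + 2 * b"
    by (simp_all add: a_def b_def)
  have F0: "int (fib m) = a" and F1: "int (fib (Suc m)) = b"
    by (simp_all add: a_def b_def)
  have L: "int (lucas m) = 2 * b - a" "int (lucas (Suc m)) = 2 * a + b"
    "int (lucas (Suc (Suc m))) = a + 3 * b" "int (lucas (Suc (Suc (Suc m)))) = 3 * a + 4 * b"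
    by (simp_all add: lucas_eq_fib a_def b_def)
  have D0: "int (fib (2 * k)) = (2 * a + b) * b"
    by (subst fib_rec_even) (simp add: k a_def b_def algebra_simps)
  have D1: "int (fib (2 * k + 1)) = b\<^sup>2 + (a + b)\<^sup>2"
    using fib_rec_odd[of k] by (simp add: k a_def b_def algebra_simps)
  have D2: "int (fib (2 * k + 2)) = (2 * a + b) * b + (b\<^sup>2 + (a + b)\<^sup>2)"
    unfolding fib_plus_2[of "2 * k"] of_nat_add D0 D1 by simp
  have form: "b\<^sup>2 - b * a - a\<^sup>2 = (- 1) ^ m"
    using fib_quadratic_form[of m] by (simp add: a_def b_def)
  show "int (fib (2 * k)) - 1 =
      (if even k then int (fib (k + 1) * lucas (k - 1)) else int (fib (k - 1) * lucas (k + 1)))"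
    unfolding D0 using form
    by (cases "even m") (simp_all add: k F0 F1 F2 L power2_eq_square algebra_simps
        del: fib.simps lucas.simps)
  show "int (fib (2 * k + 1)) - 1 =
      (if even k then int (fib k * lucas (k + 1)) else int (fib (k + 1) * lucas k))"
    unfolding D1 using form
    by (cases "even m") (simp_all add: k F0 F1 F2 L power2_eq_square algebra_simps
        del: fib.simps lucas.simps)
  show "int (fib (2 * k + 2)) - 1 =
      (if even k then int (fib k * lucas (k + 2)) else int (fib (k + 2) * lucas k))"
    unfolding D2 using form
    by (cases "even m") (simp_all add: k F1 F3 L power2_eq_square algebra_simps
        del: fib.simps lucas.simps)
qed

text \<open>Doubling everything avoids deciding which factor of each product is even.\<close>

lemma double_lcm_eq:
  fixes a b :: int and c x y :: nat
  assumes "2 * a = int c * int x" "2 * b = int c * int y" "coprime x y"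
  shows "2 * lcm a b = int (c * x * y)"
proof -
  have "2 * lcm a b = lcm (2 * a) (2 * b)"
    by (simp add: lcm_mult_left)
  also have "\<dots> = int c * lcm (int x) (int y)"
    unfolding assms by (simp add: lcm_mult_left)
  also have "lcm (int x) (int y) = int x * int y"
    using assms(3) by (simp add: lcm_coprime)
  finally show ?thesis by simp
qed

theorem theorem5:
  fixes k :: nat
  assumes "k \<ge> 1"
  shows "real_of_int (lcm (A1 (2 * k)) (A1' (2 * k))) =
    (if even k
     then 1 / 2 * real (fib (k + 1) * fib k * lucas (k + 2) * lucas (k + 1) * lucas (k - 1))
     else 1 / 2 * real (fib (k + 2) * fib (k + 1) * fib (k - 1) * lucas (k + 1) * lucas k))"
proof -
  note A = double_A1[of "2 * k"] double_A1'[of "2 * k"]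
  note fact = fib_minus_1_factorization[OF assms]
  have "2 * lcm (A1 (2 * k)) (A1' (2 * k)) =
    (if even k
     then int (fib (k + 1) * fib k * lucas (k + 2) * lucas (k + 1) * lucas (k - 1))
     else int (fib (k + 2) * fib (k + 1) * fib (k - 1) * lucas (k + 1) * lucas k))"
  proof (cases "even k")
    case True
    \<comment> \<open>The first three factors are common to both doubled sums; the last two are the
      coprime cofactors.\<close>
    have "2 * lcm (A1 (2 * k)) (A1' (2 * k)) =
      int (fib (k + 1) * lucas (k - 1) * fib k * lucas (k + 1) * lucas (k + 2))"
    proof (rule double_lcm_eq)
      show "coprime (lucas (k + 1)) (lucas (k + 2))"
        using coprime_lucas_Suc[of "k + 1"] by simp
    qed (use A fact True assms in \<open>simp_all del: fib.simps lucas.simps\<close>)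
    then show ?thesis using True by (simp only: if_True mult_ac)
  next
    case False
    \<comment> \<open>Here the cofactors are Fibonacci numbers. For \<open>k = 1\<close> the factor
      \<open>fib 0\<close> makes both sums 0.\<close>
    have "2 * lcm (A1 (2 * k)) (A1' (2 * k)) =
      int (fib (k - 1) * lucas (k + 1) * lucas k * fib (k + 1) * fib (k + 2))"
    proof (rule double_lcm_eq)
      show "coprime (fib (k + 1)) (fib (k + 2))"
        using coprime_fib_Suc_nat[of "k + 1"] by simp
    qed (use A fact False assms in \<open>simp_all del: fib.simps lucas.simps\<close>)
    then show ?thesis using False by (simp only: if_False mult_ac)
  qed
  from arg_cong[OF this, of real_of_int] show ?thesis
    by (cases "even k") (simp_all only: of_int_mult of_int_numeral of_int_of_nat_eq if_True if_False
        field_simps simp_thms)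
qed

end
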